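(* Let $T$ be a monoid and $X$ a non-empty set. There is a bijective correspondence between partial multiactions of $T$ on $X$ and premorphisms $T\to\mathcal B(X)$, sending a partial multiaction $\mathcal G$ to the premorphism $t\mapsto\varphi_t=\{(x,y)\in X\times X\colon(x,t,y)\in\mathrm E(\mathcal G)\}$. This correspondence subsumes the bijective correspondences between: (1) right (respectively left) partial actions of $T$ on $X$ and premorphisms $T\to\mathcal{PT}(X)$ (respectively $T\to\mathcal{PT}^c(X)$); (2) right (or, equivalently, left) partial actions of $T$ on $X$ by partial bijections and premorphisms $T\to\mathcal I(X)$.
   Context: **Binary relations.** $\mathcal B(X)$ is the monoid of binary relations on $X$ under composition (relations composed left to right: $(x,z)\in\varphi\psi$ iff $(x,y)\in\varphi$, $(y,z)\in\psi$ for some $y$). $\mathcal{PT}(X)$ is the submonoid of all $\tau$ such that for each $x$ there is at most one $y$ with $(x,y)\in\tau$; $\mathcal{PT}^c(X)$ is the submonoid of all $\tau$ such that for each $y$ there is at most one $x$ with $(x,y)\in\tau$; $\mathcal I(X)=\mathcal{PT}(X)\cap\mathcal{PT}^c(X)$. **Partial multiactions.** A partial multiaction $\mathcal G$ of a monoid $T$ on a non-empty set $X$ is a labelled directed graph with vertex set $X$, given by its edge set $\mathrm E(\mathcal G)\subseteq X\times T\times X$ (the edge $(x,t,y)$ goes from $x$ to $y$ and has label $t$), such that $(x,1,x)\in\mathrm E(\mathcal G)$ for all $x\in X$; for each $t\in T$ there is an edge labelled by $t$; and $(x,t,y),(y,s,z)\in\mathrm E(\mathcal G)$ imply $(x,ts,z)\in\mathrm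 E(\mathcal G)$. **Premorphisms.** A map $\varphi\colon T\to\mathcal B(X)$, $t\mapsto\varphi_t$, is a premorphism if $\varphi_t\ne\varnothing$ for all $t\in T$, $\mathrm{id}_X\subseteq\varphi_1$, and $\varphi_s\varphi_t\subseteq\varphi_{st}$ for all $s,t\in T$. A premorphism to a submonoid of $\mathcal B(X)$ is a premorphism to $\mathcal B(X)$ with values in that submonoid. **Partial actions.** A right partial action of $T$ on $X$ is a partially defined map $X\times T\to X$, $(x,t)\mapsto x\cdot t$, such that for every $t\in T$ there is $x\in X$ with $x\cdot t$ defined; if $x\cdot s$ and $(x\cdot s)\cdot t$ are defined then $x\cdot st$ is defined and $(x\cdot s)\cdot t=x\cdot st$; and $x\cdot1$ is defined and equals $x$ for all $x\in X$. Left partial actions are defined dually. A right partial action is identified with the partial multiaction with edge set $\{(x,t,x\cdot t)\colon x\cdot t\text{ is defined}\}$, and a left partial action with the partial multiaction with edge set $\{(t\cdot x,t,x)\colon t\cdot x\text{ is defined}\}$. A right (or left) partial action is by partial bijections if for every $t\in T$ the partial map $x\mapsto x\cdot t$ (respectively $x\mapsto t\cdot x$) is injective on its domain. *)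

theory Defs
  imports "HOL-Algebra.Group"
begin

text \<open>
  The monoid \<open>T\<close> is given by its carrier, so a map defined on \<open>T\<close> is taken to be
  extensional on \<open>carrier T\<close> (\<open>\<rightarrow>\<^sub>E\<close>); equality of such functions is then equality of maps.
  Relations on \<open>X\<close> are subsets of \<open>X \<times> X\<close>; their left-to-right composition is \<^term>\<open>(O)\<close>
  and the identity is \<^term>\<open>Id_on X\<close>.
\<close>

definition BR :: "'x set \<Rightarrow> 'x rel set" where
  "BR X = Pow (X \<times> X)"

definition PT :: "'x set \<Rightarrow> 'x rel set" where
  "PT X = {\<tau> \<in> BR X. single_valued \<tau>}"

definition PTc :: "'x set \<Rightarrow> 'x rel set" where
  "PTc X = {\<tau> \<in> BR X. single_valued (\<tau>\<inverse>)}"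

definition SI :: "'x set \<Rightarrow> 'x rel set" where
  "SI X = PT X \<inter> PTc X"

text \<open>A partial multiaction is represented by its edge set.\<close>

definition partial_multiactions ::
    "('t, 'm) monoid_scheme \<Rightarrow> 'x set \<Rightarrow> ('x \<times> 't \<times> 'x) set set" where
  "partial_multiactions T X = {E.
     E \<subseteq> X \<times> carrier T \<times> X \<and>
     (\<forall>x\<in>X. (x, \<one>\<^bsub>T\<^esub>, x) \<in> E) \<and>
     (\<forall>t\<in>carrier T. \<exists>x y. (x, t, y) \<in> E) \<and>
     (\<forall>x t y s z. (x, t, y) \<in> E \<longrightarrow> (y, s, z) \<in> E \<longrightarrow> (x, t \<otimes>\<^bsub>T\<^esub> s, z) \<in> E)}"

text \<open>Premorphisms from \<open>T\<close> to \<open>BR X\<close> with values in \<open>S\<close>.\<close>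

definition premorphisms ::
    "('t, 'm) monoid_scheme \<Rightarrow> 'x set \<Rightarrow> 'x rel set \<Rightarrow> ('t \<Rightarrow> 'x rel) set" where
  "premorphisms T X S = {\<phi> \<in> carrier T \<rightarrow>\<^sub>E BR X.
     (\<forall>t\<in>carrier T. \<phi> t \<in> S) \<and>
     (\<forall>t\<in>carrier T. \<phi> t \<noteq> {}) \<and>
     Id_on X \<subseteq> \<phi> \<one>\<^bsub>T\<^esub> \<and>
     (\<forall>s\<in>carrier T. \<forall>t\<in>carrier T. \<phi> s O \<phi> t \<subseteq> \<phi> (s \<otimes>\<^bsub>T\<^esub> t))}"

definition multiaction_premorphism ::
    "('t, 'm) monoid_scheme \<Rightarrow> 'x set \<Rightarrow> ('x \<times> 't \<times> 'x) set \<Rightarrow> 't \<Rightarrow> 'x rel" where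
  "multiaction_premorphism T X E = (\<lambda>t\<in>carrier T. {(x, y) \<in> X \<times> X. (x, t, y) \<in> E})"

text \<open>
  \<open>\<alpha> (x, t) = Some y\<close> means that \<open>x \<cdot> t\<close> is defined and equals \<open>y\<close>; for left partial actions
  \<open>\<beta> (t, x) = Some y\<close> means that \<open>t \<cdot> x\<close> is defined and equals \<open>y\<close>.
\<close>

definition right_partial_actions ::
    "('t, 'm) monoid_scheme \<Rightarrow> 'x set \<Rightarrow> ('x \<times> 't \<rightharpoonup> 'x) set" where
  "right_partial_actions T X = {\<alpha>.
     dom \<alpha> \<subseteq> X \<times> carrier T \<and> ran \<alpha> \<subseteq> X \<and>
     (\<forall>t\<in>carrier T. \<exists>x\<in>X. (x, t) \<in> dom \<alpha>) \<and>
     (\<forall>x\<in>X. \<forall>s\<in>carrier T. \<forall>t\<in>carrier T. \<forall>y z.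
        \<alpha> (x, s) = Some y \<longrightarrow> \<alpha> (y, t) = Some z \<longrightarrow> \<alpha> (x, s \<otimes>\<^bsub>T\<^esub> t) = Some z) \<and>
     (\<forall>x\<in>X. \<alpha> (x, \<one>\<^bsub>T\<^esub>) = Some x)}"

definition left_partial_actions ::
    "('t, 'm) monoid_scheme \<Rightarrow> 'x set \<Rightarrow> ('t \<times> 'x \<rightharpoonup> 'x) set" where
  "left_partial_actions T X = {\<beta>.
     dom \<beta> \<subseteq> carrier T \<times> X \<and> ran \<beta> \<subseteq> X \<and>
     (\<forall>t\<in>carrier T. \<exists>x\<in>X. (t, x) \<in> dom \<beta>) \<and>
     (\<forall>x\<in>X. \<forall>s\<in>carrier T. \<forall>t\<in>carrier T. \<forall>y z.
        \<beta> (t, x) = Some y \<longrightarrow> \<beta> (s, y) = Some z \<longrightarrow> \<beta> (s \<otimes>\<^bsub>T\<^esub> t, x) = Some z) \<and>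
     (\<forall>x\<in>X. \<beta> (\<one>\<^bsub>T\<^esub>, x) = Some x)}"

definition right_partial_actions_by_bijections ::
    "('t, 'm) monoid_scheme \<Rightarrow> 'x set \<Rightarrow> ('x \<times> 't \<rightharpoonup> 'x) set" where
  "right_partial_actions_by_bijections T X = {\<alpha> \<in> right_partial_actions T X.
     \<forall>t\<in>carrier T. inj_on (\<lambda>x. \<alpha> (x, t)) {x. (x, t) \<in> dom \<alpha>}}"

definition left_partial_actions_by_bijections ::
    "('t, 'm) monoid_scheme \<Rightarrow> 'x set \<Rightarrow> ('t \<times> 'x \<rightharpoonup> 'x) set" where
  "left_partial_actions_by_bijections T X = {\<beta> \<in> left_partial_actions T X.
     \<forall>t\<in>carrier T. inj_on (\<lambda>x. \<beta> (t, x)) {x. (t, x) \<in> dom \<beta>}}"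

text \<open>
  The identification of partial actions with partial multiactions; in the left case the edge
  goes from \<open>t \<cdot> x\<close> to \<open>x\<close>.
\<close>

definition right_edges :: "('x \<times> 't \<rightharpoonup> 'x) \<Rightarrow> ('x \<times> 't \<times> 'x) set" where
  "right_edges \<alpha> = {(x, t, y). \<alpha> (x, t) = Some y}"

definition left_edges :: "('t \<times> 'x \<rightharpoonup> 'x) \<Rightarrow> ('x \<times> 't \<times> 'x) set" where
  "left_edges \<beta> = {(y, t, x). \<beta> (t, x) = Some y}"

end

theory Submission
  imports Defs
begin

text \<open>
  A set of labelled edges and a family of relations indexed by the labels are the same data, by
  currying: the relation belonging to \<open>t\<close> is the fibre of the edge set over \<open>t\<close>. Under this
  currying the axioms of a partial multiaction turn, one by one, into the axioms of a premorphism
  (loops labelled by the unit, nonempty fibres, closure under composition of edges), which gives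
  the general correspondence; see \<open>bij_betw_multiaction_premorphism\<close>.

  Since the correspondence is fibrewise, it restricts for each set \<open>S\<close> of relations to a bijection
  between the multiactions all of whose fibres lie in \<open>S\<close> and the premorphisms with values in \<open>S\<close>.
  All special cases follow once the multiactions with fibres in \<open>PT X\<close>, \<open>PTc X\<close> and \<open>SI X\<close> are
  recognised as the edge sets of right partial actions, of left partial actions, and of
  partial actions by partial bijections on either side. This rests on two independent facts. The
  edge sets of partially defined maps are those with single-valued fibres (in the direction that
  is relevant to the side), and a partially defined map is a partial action as soon as
  its edge set is a partial multiaction. In the bijective case both sides lead to the same set of
  multiactions, because injectivity of a partial map means that the converse of its graph is
  single-valued.
\<close>

section \<open>Multiactions with prescribed fibres\<close>

definition multiactions_with_fibres_in ::
    "('t, 'm) monoid_scheme \<Rightarrow> 'x set \<Rightarrow> 'x rel set \<Rightarrow> ('x \<times> 't \<times> 'x) set set" where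
  "multiactions_with_fibres_in T X S =
     {E \<in> partial_multiactions T X. \<forall>t\<in>carrier T. multiaction_premorphism T X E t \<in> S}"

lemma mem_partial_multiactionsD:
  assumes "E \<in> partial_multiactions T X" and "(x, t, y) \<in> E"
  shows "x \<in> X" and "t \<in> carrier T" and "y \<in> X"
  using assms unfolding partial_multiactions_def by auto

lemma mem_multiaction_premorphism_iff:
  assumes "E \<in> partial_multiactions T X" and "t \<in> carrier T"
  shows "(x, y) \<in> multiaction_premorphism T X E t \<longleftrightarrow> (x, t, y) \<in> E"
  using assms mem_partial_multiactionsD[OF assms(1)]
  by (auto simp: multiaction_premorphism_def)

lemma multiaction_premorphism_in_premorphisms:
  assumes E: "E \<in> partial_multiactions T X"
  shows "multiaction_premorphism T X E \<in> premorphisms T X (BR X)"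
proof -
  let ?\<phi> = "multiaction_premorphism T X E"
  note mem = mem_multiaction_premorphism_iff[OF E]
  note carrier = mem_partial_multiactionsD[OF E]
  have ext: "?\<phi> \<in> carrier T \<rightarrow>\<^sub>E BR X"
    unfolding multiaction_premorphism_def
    by (rule restrict_PiE_iff[THEN iffD2]) (simp add: BR_def, blast)
  have nonempty: "?\<phi> t \<noteq> {}" if "t \<in> carrier T" for t
  proof -
    have "\<forall>t\<in>carrier T. \<exists>x y. (x, t, y) \<in> E"
      using E by (simp add: partial_multiactions_def)
    with that obtain x y where "(x, t, y) \<in> E" by metis
    then have "(x, y) \<in> ?\<phi> t"
      by (simp add: mem that)
    then show ?thesis by blast
  qed
  have unit: "Id_on X \<subseteq> ?\<phi> \<one>\<^bsub>T\<^esub>"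
  proof
    fix p assume "p \<in> Id_on X"
    then obtain x where x: "p = (x, x)" "x \<in> X" by blast
    then have loop: "(x, \<one>\<^bsub>T\<^esub>, x) \<in> E"
      using E unfolding partial_multiactions_def by blast
    then show "p \<in> ?\<phi> \<one>\<^bsub>T\<^esub>"
      using carrier(2)[OF loop] by (simp add: mem x(1))
  qed
  have mult: "?\<phi> s O ?\<phi> t \<subseteq> ?\<phi> (s \<otimes>\<^bsub>T\<^esub> t)"
    if st: "s \<in> carrier T" "t \<in> carrier T" for s t
  proof
    fix p assume "p \<in> ?\<phi> s O ?\<phi> t"
    then obtain x y z where p: "p = (x, z)" and "(x, y) \<in> ?\<phi> s" "(y, z) \<in> ?\<phi> t" by blast
    then have "(x, s, y) \<in> E" "(y, t, z) \<in> E"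
      by (simp_all add: mem st)
    then have comp: "(x, s \<otimes>\<^bsub>T\<^esub> t, z) \<in> E"
      using E unfolding partial_multiactions_def by blast
    then show "p \<in> ?\<phi> (s \<otimes>\<^bsub>T\<^esub> t)"
      using carrier(2)[OF comp] by (simp add: mem p)
  qed
  show ?thesis
    using ext nonempty unit mult unfolding premorphisms_def by auto
qed

text \<open>
  The inverse of currying. Closure of the carrier under products and the unit guarantees that a
  composed edge and a loop have an admissible label; extensionality of \<open>\<phi>\<close> gives the
  equality of maps outside the carrier.
\<close>

lemma uncurry_premorphism:
  assumes "monoid T" and \<phi>: "\<phi> \<in> premorphisms T X (BR X)"
  defines "E \<equiv> {(x, t, y). t \<in> carrier T \<and> (x, y) \<in> \<phi> t}"
  shows "E \<in> partial_multiactions T X" and "multiaction_premorphism T X E = \<phi>"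
proof -
  interpret monoid T by fact
  have ext: "\<phi> \<in> carrier T \<rightarrow>\<^sub>E BR X"
    and nonempty: "\<And>t. t \<in> carrier T \<Longrightarrow> \<phi> t \<noteq> {}"
    and unit: "Id_on X \<subseteq> \<phi> \<one>\<^bsub>T\<^esub>"
    and mult: "\<And>s t. s \<in> carrier T \<Longrightarrow> t \<in> carrier T \<Longrightarrow> \<phi> s O \<phi> t \<subseteq> \<phi> (s \<otimes>\<^bsub>T\<^esub> t)"
    using \<phi> unfolding premorphisms_def by auto
  have fibre: "\<phi> t \<subseteq> X \<times> X" if "t \<in> carrier T" for t
    using PiE_mem[OF ext that] by (simp add: BR_def)
  have sub: "E \<subseteq> X \<times> carrier T \<times> X"
    using fibre by (auto simp: E_def)
  have loops: "(x, \<one>\<^bsub>T\<^esub>, x) \<in> E" if "x \<in> X" for x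
    using unit that by (auto simp: E_def)
  have labels: "\<exists>x y. (x, t, y) \<in> E" if "t \<in> carrier T" for t
    using nonempty[OF that] that by (auto simp: E_def)
  have comp: "(x, t \<otimes>\<^bsub>T\<^esub> s, z) \<in> E" if "(x, t, y) \<in> E" "(y, s, z) \<in> E" for x t y s z
    using mult[of t s] that by (auto simp: E_def)
  show "E \<in> partial_multiactions T X"
    unfolding partial_multiactions_def using sub loops labels comp by blast
  show "multiaction_premorphism T X E = \<phi>"
  proof
    fix t
    show "multiaction_premorphism T X E t = \<phi> t"
    proof (cases "t \<in> carrier T")
      case True
      then show ?thesis
        using fibre[OF True] by (auto simp: multiaction_premorphism_def E_def)
    next
      case False
      then show ?thesis
        using PiE_arb[OF ext False] by (simp add: multiaction_premorphism_def)
    qed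
  qed
qed

theorem bij_betw_multiaction_premorphism:
  assumes "monoid T"
  shows "bij_betw (multiaction_premorphism T X) (partial_multiactions T X)
    (premorphisms T X (BR X))"
proof (rule bij_betw_imageI)
  show "inj_on (multiaction_premorphism T X) (partial_multiactions T X)"
  proof (rule inj_onI)
    fix E F
    assume EF: "E \<in> partial_multiactions T X" "F \<in> partial_multiactions T X"
      and eq: "multiaction_premorphism T X E = multiaction_premorphism T X F"
    have "(x, t, y) \<in> E \<longleftrightarrow> (x, t, y) \<in> F" for x t y
    proof (cases "t \<in> carrier T")
      case True
      then show ?thesis
        using mem_multiaction_premorphism_iff[OF EF(1)] mem_multiaction_premorphism_iff[OF EF(2)] eq
        by metis
    next
      case False
      then show ?thesis
        using mem_partial_multiactionsD(2)[OF EF(1)] mem_partial_multiactionsD(2)[OF EF(2)] by blast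
    qed
    then show "E = F" by auto
  qed
  show "multiaction_premorphism T X ` partial_multiactions T X = premorphisms T X (BR X)"
  proof
    show "multiaction_premorphism T X ` partial_multiactions T X \<subseteq> premorphisms T X (BR X)"
      using multiaction_premorphism_in_premorphisms by blast
    show "premorphisms T X (BR X) \<subseteq> multiaction_premorphism T X ` partial_multiactions T X"
    proof
      fix \<phi> assume "\<phi> \<in> premorphisms T X (BR X)"
      note uncurried = uncurry_premorphism[OF assms this]
      show "\<phi> \<in> multiaction_premorphism T X ` partial_multiactions T X"
        using imageI[OF uncurried(1), of "multiaction_premorphism T X"] unfolding uncurried(2) .
    qed
  qed
qed

lemma premorphisms_eq_restrict_values:
  "premorphisms T X S = {\<phi> \<in> premorphisms T X (BR X). \<forall>t\<in>carrier T. \<phi> t \<in> S}"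
proof -
  have "\<phi> t \<in> BR X" if "\<phi> \<in> carrier T \<rightarrow>\<^sub>E BR X" "t \<in> carrier T" for \<phi> t
    using that by (rule PiE_mem)
  then show ?thesis
    unfolding premorphisms_def by blast
qed

corollary bij_betw_multiactions_with_fibres_in:
  assumes "monoid T"
  shows "bij_betw (multiaction_premorphism T X) (multiactions_with_fibres_in T X S)
    (premorphisms T X S)"
proof (rule bij_betw_subset[OF bij_betw_multiaction_premorphism[OF assms]])
  show "multiactions_with_fibres_in T X S \<subseteq> partial_multiactions T X"
    by (auto simp: multiactions_with_fibres_in_def)
  have "premorphisms T X (BR X) = multiaction_premorphism T X ` partial_multiactions T X"
    by (rule bij_betw_imp_surj_on[OF bij_betw_multiaction_premorphism[OF assms], symmetric])
  then show "multiaction_premorphism T X ` multiactions_with_fibres_in T X S = premorphisms T X S"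
    unfolding premorphisms_eq_restrict_values[of T X S] multiactions_with_fibres_in_def by auto
qed

section \<open>Deterministic and codeterministic multiactions\<close>

lemma multiactions_with_fibres_in_PT:
  "multiactions_with_fibres_in T X (PT X) =
     {E \<in> partial_multiactions T X. \<forall>x t y z. (x, t, y) \<in> E \<longrightarrow> (x, t, z) \<in> E \<longrightarrow> y = z}"
proof -
  have "(\<forall>t\<in>carrier T. multiaction_premorphism T X E t \<in> PT X) \<longleftrightarrow>
      (\<forall>x t y z. (x, t, y) \<in> E \<longrightarrow> (x, t, z) \<in> E \<longrightarrow> y = z)"
    if E: "E \<in> partial_multiactions T X" for E
  proof -
    have "multiaction_premorphism T X E t \<in> BR X" if "t \<in> carrier T" for t
      using that by (auto simp: multiaction_premorphism_def BR_def)
    then show ?thesis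
      using mem_partial_multiactionsD(2)[OF E]
      by (simp add: PT_def single_valued_def mem_multiaction_premorphism_iff[OF E]) blast
  qed
  then show ?thesis
    unfolding multiactions_with_fibres_in_def by blast
qed

lemma multiactions_with_fibres_in_PTc:
  "multiactions_with_fibres_in T X (PTc X) =
     {E \<in> partial_multiactions T X. \<forall>x y t z. (x, t, z) \<in> E \<longrightarrow> (y, t, z) \<in> E \<longrightarrow> x = y}"
proof -
  have "(\<forall>t\<in>carrier T. multiaction_premorphism T X E t \<in> PTc X) \<longleftrightarrow>
      (\<forall>x y t z. (x, t, z) \<in> E \<longrightarrow> (y, t, z) \<in> E \<longrightarrow> x = y)"
    if E: "E \<in> partial_multiactions T X" for E
  proof -
    have "multiaction_premorphism T X E t \<in> BR X" if "t \<in> carrier T" for t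
      using that by (auto simp: multiaction_premorphism_def BR_def)
    then show ?thesis
      using mem_partial_multiactionsD(2)[OF E]
      by (simp add: PTc_def single_valued_def mem_multiaction_premorphism_iff[OF E]) blast
  qed
  then show ?thesis
    unfolding multiactions_with_fibres_in_def by blast
qed

lemma multiactions_with_fibres_in_SI:
  "multiactions_with_fibres_in T X (SI X) =
     multiactions_with_fibres_in T X (PT X) \<inter> multiactions_with_fibres_in T X (PTc X)"
  by (auto simp: multiactions_with_fibres_in_def SI_def)

section \<open>Partial actions as multiactions\<close>

lemma mem_right_edges_iff [simp]: "(x, t, y) \<in> right_edges \<alpha> \<longleftrightarrow> \<alpha> (x, t) = Some y"
  by (simp add: right_edges_def)

lemma mem_left_edges_iff [simp]: "(y, t, x) \<in> left_edges \<beta> \<longleftrightarrow> \<beta> (t, x) = Some y"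
  by (simp add: left_edges_def)

lemma inj_right_edges: "inj (right_edges :: ('x \<times> 't \<rightharpoonup> 'x) \<Rightarrow> _)"
proof (rule injI, rule ext)
  fix \<alpha> \<alpha>' :: "'x \<times> 't \<rightharpoonup> 'x" and p
  assume "right_edges \<alpha> = right_edges \<alpha>'"
  then have "\<alpha> (x, t) = Some y \<longleftrightarrow> \<alpha>' (x, t) = Some y" for x t y
    by (metis mem_right_edges_iff)
  then show "\<alpha> p = \<alpha>' p"
    by (cases p) (metis option.exhaust)
qed

lemma inj_left_edges: "inj (left_edges :: ('t \<times> 'x \<rightharpoonup> 'x) \<Rightarrow> _)"
proof (rule injI, rule ext)
  fix \<beta> \<beta>' :: "'t \<times> 'x \<rightharpoonup> 'x" and p
  assume "left_edges \<beta> = left_edges \<beta>'"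
  then have "\<beta> (t, x) = Some y \<longleftrightarrow> \<beta>' (t, x) = Some y" for x t y
    by (metis mem_left_edges_iff)
  then show "\<beta> p = \<beta>' p"
    by (cases p) (metis option.exhaust)
qed

lemma right_edges_surj:
  assumes "\<And>x t y z. (x, t, y) \<in> E \<Longrightarrow> (x, t, z) \<in> E \<Longrightarrow> y = z"
  obtains \<alpha> where "E = right_edges \<alpha>"
proof -
  have "\<forall>p. \<exists>v. \<forall>y. (fst p, snd p, y) \<in> E \<longleftrightarrow> v = Some y"
  proof
    fix p
    show "\<exists>v. \<forall>y. (fst p, snd p, y) \<in> E \<longleftrightarrow> v = Some y"
    proof (cases "\<exists>y. (fst p, snd p, y) \<in> E")
      case True
      then obtain y where y: "(fst p, snd p, y) \<in> E" ..
      have "(fst p, snd p, z) \<in> E \<longleftrightarrow> Some y = Some z" for z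
        using assms[OF y] y unfolding option.inject by metis
      then show ?thesis by (intro exI[of _ "Some y"] allI)
    next
      case False
      then show ?thesis by (intro exI[of _ None]) simp
    qed
  qed
  from choice[OF this] obtain \<alpha> where \<alpha>: "\<And>p y. (fst p, snd p, y) \<in> E \<longleftrightarrow> \<alpha> p = Some y"
    by blast
  have "p \<in> E \<longleftrightarrow> p \<in> right_edges \<alpha>" for p
    using \<alpha>[of "(fst p, fst (snd p))" "snd (snd p)"] by (cases p) simp
  then have "E = right_edges \<alpha>"
    by blast
  then show thesis
    by (rule that)
qed

lemma left_edges_surj:
  assumes "\<And>x y t z. (x, t, z) \<in> E \<Longrightarrow> (y, t, z) \<in> E \<Longrightarrow> x = y"
  obtains \<beta> where "E = left_edges \<beta>"
proof -
  have "\<forall>p. \<exists>v. \<forall>y. (y, fst p, snd p) \<in> E \<longleftrightarrow> v = Some y"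
  proof
    fix p
    show "\<exists>v. \<forall>y. (y, fst p, snd p) \<in> E \<longleftrightarrow> v = Some y"
    proof (cases "\<exists>y. (y, fst p, snd p) \<in> E")
      case True
      then obtain y where y: "(y, fst p, snd p) \<in> E" ..
      have "(z, fst p, snd p) \<in> E \<longleftrightarrow> Some y = Some z" for z
        using assms[OF y] y unfolding option.inject by metis
      then show ?thesis by (intro exI[of _ "Some y"] allI)
    next
      case False
      then show ?thesis by (intro exI[of _ None]) simp
    qed
  qed
  from choice[OF this] obtain \<beta> where \<beta>: "\<And>p y. (y, fst p, snd p) \<in> E \<longleftrightarrow> \<beta> p = Some y"
    by blast
  have "p \<in> E \<longleftrightarrow> p \<in> left_edges \<beta>" for p
    using \<beta>[of "fst p" "snd p"] by (cases p) simp
  then have "E = left_edges \<beta>"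
    by blast
  then show thesis
    by (rule that)
qed

text \<open>
  The axioms of a right partial action are those of a partial multiaction, read off the graph. The
  quantifiers of the multiplicativity axiom, bounded on one side and not on the other, agree
  because every edge has its ends in \<open>X\<close> and its label in the monoid.
\<close>

lemma right_edges_mem_partial_multiactions_iff:
  "right_edges \<alpha> \<in> partial_multiactions T X \<longleftrightarrow> \<alpha> \<in> right_partial_actions T X"
proof -
  have sub: "right_edges \<alpha> \<subseteq> X \<times> carrier T \<times> X \<longleftrightarrow> dom \<alpha> \<subseteq> X \<times> carrier T \<and> ran \<alpha> \<subseteq> X"
    by (fastforce simp: right_edges_def dom_def ran_def)
  show ?thesis
  proof (cases "right_edges \<alpha> \<subseteq> X \<times> carrier T \<times> X")
    case False
    then show ?thesis
      unfolding partial_multiactions_def right_partial_actions_def using sub by blast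
  next
    case True
    then have bounds: "x \<in> X \<and> t \<in> carrier T \<and> y \<in> X" if "\<alpha> (x, t) = Some y" for x t y
      using that by (auto simp: right_edges_def)
    have labels: "(\<forall>t\<in>carrier T. \<exists>x y. (x, t, y) \<in> right_edges \<alpha>) \<longleftrightarrow>
        (\<forall>t\<in>carrier T. \<exists>x\<in>X. (x, t) \<in> dom \<alpha>)"
      by (simp add: dom_def Bex_def) (metis bounds)
    have comp: "(\<forall>x t y s z. (x, t, y) \<in> right_edges \<alpha> \<longrightarrow> (y, s, z) \<in> right_edges \<alpha> \<longrightarrow>
          (x, t \<otimes>\<^bsub>T\<^esub> s, z) \<in> right_edges \<alpha>) \<longleftrightarrow>
        (\<forall>x\<in>X. \<forall>s\<in>carrier T. \<forall>t\<in>carrier T. \<forall>y z.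
          \<alpha> (x, s) = Some y \<longrightarrow> \<alpha> (y, t) = Some z \<longrightarrow> \<alpha> (x, s \<otimes>\<^bsub>T\<^esub> t) = Some z)"
      unfolding mem_right_edges_iff using bounds by blast
    show ?thesis
      unfolding partial_multiactions_def right_partial_actions_def mem_Collect_eq labels comp
      using True sub by simp blast
  qed
qed

text \<open>
  The edge of a left partial action runs from \<open>t \<cdot> x\<close> to \<open>x\<close>, so the path composed of the edges
  of \<open>s \<cdot> (t \<cdot> x)\<close> and \<open>t \<cdot> x\<close> carries the labels in the order \<open>s\<close>, \<open>t\<close>. Hence the same
  monoid, rather than its opposite, acts on the left.
\<close>

lemma left_edges_mem_partial_multiactions_iff:
  "left_edges \<beta> \<in> partial_multiactions T X \<longleftrightarrow> \<beta> \<in> left_partial_actions T X"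
proof -
  have sub: "left_edges \<beta> \<subseteq> X \<times> carrier T \<times> X \<longleftrightarrow> dom \<beta> \<subseteq> carrier T \<times> X \<and> ran \<beta> \<subseteq> X"
    by (fastforce simp: left_edges_def dom_def ran_def)
  show ?thesis
  proof (cases "left_edges \<beta> \<subseteq> X \<times> carrier T \<times> X")
    case False
    then show ?thesis
      unfolding partial_multiactions_def left_partial_actions_def using sub by blast
  next
    case True
    then have bounds: "x \<in> X \<and> t \<in> carrier T \<and> y \<in> X" if "\<beta> (t, x) = Some y" for x t y
      using that by (auto simp: left_edges_def)
    have labels: "(\<forall>t\<in>carrier T. \<exists>x y. (x, t, y) \<in> left_edges \<beta>) \<longleftrightarrow>
        (\<forall>t\<in>carrier T. \<exists>x\<in>X. (t, x) \<in> dom \<beta>)"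
      by (simp add: dom_def Bex_def) (metis bounds)
    have comp: "(\<forall>x t y s z. (x, t, y) \<in> left_edges \<beta> \<longrightarrow> (y, s, z) \<in> left_edges \<beta> \<longrightarrow>
          (x, t \<otimes>\<^bsub>T\<^esub> s, z) \<in> left_edges \<beta>) \<longleftrightarrow>
        (\<forall>x\<in>X. \<forall>s\<in>carrier T. \<forall>t\<in>carrier T. \<forall>y z.
          \<beta> (t, x) = Some y \<longrightarrow> \<beta> (s, y) = Some z \<longrightarrow> \<beta> (s \<otimes>\<^bsub>T\<^esub> t, x) = Some z)"
      unfolding mem_left_edges_iff using bounds by blast
    show ?thesis
      unfolding partial_multiactions_def left_partial_actions_def mem_Collect_eq labels comp
      using True sub by simp blast
  qed
qed

proposition right_edges_image_right_partial_actions: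
  "right_edges ` right_partial_actions T X = multiactions_with_fibres_in T X (PT X)"
proof
  show "right_edges ` right_partial_actions T X \<subseteq> multiactions_with_fibres_in T X (PT X)"
    unfolding multiactions_with_fibres_in_PT
    by (auto simp: right_edges_mem_partial_multiactions_iff)
  show "multiactions_with_fibres_in T X (PT X) \<subseteq> right_edges ` right_partial_actions T X"
  proof
    fix E assume E: "E \<in> multiactions_with_fibres_in T X (PT X)"
    then have "y = z" if "(x, t, y) \<in> E" "(x, t, z) \<in> E" for x t y z
      using that unfolding multiactions_with_fibres_in_PT mem_Collect_eq by metis
    then obtain \<alpha> where "E = right_edges \<alpha>"
      by (rule right_edges_surj)
    with E show "E \<in> right_edges ` right_partial_actions T X"
      by (auto simp: multiactions_with_fibres_in_def right_edges_mem_partial_multiactions_iff)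
  qed
qed

proposition left_edges_image_left_partial_actions:
  "left_edges ` left_partial_actions T X = multiactions_with_fibres_in T X (PTc X)"
proof
  show "left_edges ` left_partial_actions T X \<subseteq> multiactions_with_fibres_in T X (PTc X)"
    unfolding multiactions_with_fibres_in_PTc
    by (auto simp: left_edges_mem_partial_multiactions_iff)
  show "multiactions_with_fibres_in T X (PTc X) \<subseteq> left_edges ` left_partial_actions T X"
  proof
    fix E assume E: "E \<in> multiactions_with_fibres_in T X (PTc X)"
    then have "x = y" if "(x, t, z) \<in> E" "(y, t, z) \<in> E" for x y t z
      using that unfolding multiactions_with_fibres_in_PTc mem_Collect_eq by metis
    then obtain \<beta> where "E = left_edges \<beta>"
      by (rule left_edges_surj)
    with E show "E \<in> left_edges ` left_partial_actions T X"
      by (auto simp: multiactions_with_fibres_in_def left_edges_mem_partial_multiactions_iff)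
  qed
qed

text \<open>
  A right partial action already has single-valued fibres; injectivity of its partial maps says
  that no two edges with the same label share a target, which is the condition for \<open>PTc X\<close>.
\<close>

lemma right_partial_actions_by_bijections_iff:
  "\<alpha> \<in> right_partial_actions_by_bijections T X \<longleftrightarrow>
     \<alpha> \<in> right_partial_actions T X \<and> right_edges \<alpha> \<in> multiactions_with_fibres_in T X (PTc X)"
proof -
  have "(\<forall>t\<in>carrier T. inj_on (\<lambda>x. \<alpha> (x, t)) {x. (x, t) \<in> dom \<alpha>}) \<longleftrightarrow>
      (\<forall>x y t z. \<alpha> (x, t) = Some z \<longrightarrow> \<alpha> (y, t) = Some z \<longrightarrow> x = y)"
    if "\<alpha> \<in> right_partial_actions T X"
  proof -
    have "t \<in> carrier T" if "\<alpha> (x, t) = Some z" for x t z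
      using that \<open>\<alpha> \<in> right_partial_actions T X\<close> by (auto simp: right_partial_actions_def)
    then show ?thesis
      by (simp add: inj_on_def dom_def) metis
  qed
  then show ?thesis
    unfolding right_partial_actions_by_bijections_def multiactions_with_fibres_in_PTc
    by (auto simp: right_edges_mem_partial_multiactions_iff)
qed

lemma left_partial_actions_by_bijections_iff:
  "\<beta> \<in> left_partial_actions_by_bijections T X \<longleftrightarrow>
     \<beta> \<in> left_partial_actions T X \<and> left_edges \<beta> \<in> multiactions_with_fibres_in T X (PT X)"
proof -
  have "(\<forall>t\<in>carrier T. inj_on (\<lambda>x. \<beta> (t, x)) {x. (t, x) \<in> dom \<beta>}) \<longleftrightarrow>
      (\<forall>x t y z. \<beta> (t, y) = Some x \<longrightarrow> \<beta> (t, z) = Some x \<longrightarrow> y = z)"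
    if "\<beta> \<in> left_partial_actions T X"
  proof -
    have "t \<in> carrier T" if "\<beta> (t, x) = Some z" for x t z
      using that \<open>\<beta> \<in> left_partial_actions T X\<close> by (auto simp: left_partial_actions_def)
    then show ?thesis
      by (simp add: inj_on_def dom_def) metis
  qed
  then show ?thesis
    unfolding left_partial_actions_by_bijections_def multiactions_with_fibres_in_PT
    by (auto simp: left_edges_mem_partial_multiactions_iff)
qed

proposition right_edges_image_right_partial_actions_by_bijections:
  "right_edges ` right_partial_actions_by_bijections T X = multiactions_with_fibres_in T X (SI X)"
  unfolding multiactions_with_fibres_in_SI right_edges_image_right_partial_actions[symmetric]
  using right_partial_actions_by_bijections_iff by blast

proposition left_edges_image_left_partial_actions_by_bijections:
  "left_edges ` left_partial_actions_by_bijections T X = multiactions_with_fibres_in T X (SI X)"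
  unfolding multiactions_with_fibres_in_SI left_edges_image_left_partial_actions[symmetric]
  using left_partial_actions_by_bijections_iff by blast

lemma bij_betw_premorphisms_of_edges:
  assumes "monoid T" and "inj edges" and "edges ` A = multiactions_with_fibres_in T X S"
  shows "bij_betw (multiaction_premorphism T X \<circ> edges) A (premorphisms T X S)"
proof (rule bij_betw_trans)
  show "bij_betw edges A (multiactions_with_fibres_in T X S)"
    using assms(2,3) by (auto simp: bij_betw_def intro: inj_on_subset)
  show "bij_betw (multiaction_premorphism T X) (multiactions_with_fibres_in T X S)
      (premorphisms T X S)"
    using assms(1) by (rule bij_betw_multiactions_with_fibres_in)
qed

section \<open>The correspondence and its restrictions\<close>

theorem corollary6p6:
  fixes T :: "('t, 'm) monoid_scheme" and X :: "'x set"
  assumes "monoid T" and "X \<noteq> {}"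
  shows
    "bij_betw (multiaction_premorphism T X) (partial_multiactions T X) (premorphisms T X (BR X))
     \<and> (right_edges ` right_partial_actions T X \<subseteq> partial_multiactions T X
        \<and> inj_on right_edges (right_partial_actions T X)
        \<and> bij_betw (multiaction_premorphism T X \<circ> right_edges)
            (right_partial_actions T X) (premorphisms T X (PT X)))
     \<and> (left_edges ` left_partial_actions T X \<subseteq> partial_multiactions T X
        \<and> inj_on left_edges (left_partial_actions T X)
        \<and> bij_betw (multiaction_premorphism T X \<circ> left_edges)
            (left_partial_actions T X) (premorphisms T X (PTc X)))
     \<and> (bij_betw (multiaction_premorphism T X \<circ> right_edges)
            (right_partial_actions_by_bijections T X) (premorphisms T X (SI X))
        \<and> bij_betw (multiaction_premorphism T X \<circ> left_edges)
            (left_partial_actions_by_bijections T X) (premorphisms T X (SI X))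
        \<and> right_edges ` right_partial_actions_by_bijections T X
            = left_edges ` left_partial_actions_by_bijections T X)"
proof (intro conjI)
  note restricted = bij_betw_premorphisms_of_edges[OF assms(1)]
  show "bij_betw (multiaction_premorphism T X) (partial_multiactions T X) (premorphisms T X (BR X))"
    using assms(1) by (rule bij_betw_multiaction_premorphism)
  show "right_edges ` right_partial_actions T X \<subseteq> partial_multiactions T X"
    by (auto simp: right_edges_mem_partial_multiactions_iff)
  show "inj_on right_edges (right_partial_actions T X)"
    using inj_right_edges by (rule inj_on_subset) simp
  show "bij_betw (multiaction_premorphism T X \<circ> right_edges)
      (right_partial_actions T X) (premorphisms T X (PT X))"
    by (rule restricted[OF inj_right_edges right_edges_image_right_partial_actions])
  show "left_edges ` left_partial_actions T X \<subseteq> partial_multiactions T X"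
    by (auto simp: left_edges_mem_partial_multiactions_iff)
  show "inj_on left_edges (left_partial_actions T X)"
    using inj_left_edges by (rule inj_on_subset) simp
  show "bij_betw (multiaction_premorphism T X \<circ> left_edges)
      (left_partial_actions T X) (premorphisms T X (PTc X))"
    by (rule restricted[OF inj_left_edges left_edges_image_left_partial_actions])
  show "bij_betw (multiaction_premorphism T X \<circ> right_edges)
      (right_partial_actions_by_bijections T X) (premorphisms T X (SI X))"
    by (rule restricted[OF inj_right_edges right_edges_image_right_partial_actions_by_bijections])
  show "bij_betw (multiaction_premorphism T X \<circ> left_edges)
      (left_partial_actions_by_bijections T X) (premorphisms T X (SI X))"
    by (rule restricted[OF inj_left_edges left_edges_image_left_partial_actions_by_bijections])
  show "right_edges ` right_partial_actions_by_bijections T X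
      = left_edges ` left_partial_actions_by_bijections T X"
    by (simp only: right_edges_image_right_partial_actions_by_bijections
        left_edges_image_left_partial_actions_by_bijections)
qed

end
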